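(* Let $T$ be a balanced tree with characteristic tuple $C_T = (c_1, c_2, \ldots, c_l)$, and let $\Phi$ be the set of integers $1 \le j \le l+1$ such that $n_{l+1-j} > n_{l-j}$. Then $$\sigma^*(T) = \bigcup_{j \in \Phi} \{ x \colon Q_j(x) = 0\}.$$
   Context: For a finite simple graph $G$, $\sigma^*(G)$ denotes the set of all distinct eigenvalues of its adjacency matrix $A(G)$. A balanced tree is an unweighted rooted tree in which all vertices of the same level have equal degree. Its levels are numbered $0,\dots,l$, where level $0$ contains only the root and level $l$ contains the leaves. The characteristic tuple of a balanced tree $T$ is the tuple of positive integers $C_T=(c_1,\dots,c_l)$, where $c_j$ is the number of children of each vertex in level $j-1$, for $1\le j\le l$ (this determines $T$ up to isomorphism). The number of vertices in level $j$ is denoted $n_j$, so that $n_0=1$ and $n_j=n_{j-1}c_j$ for $1\le j\le l$; by convention $n_{-1}=0$. The polynomials $Q_0(x),\dots,Q_{l+1}(x)$ are defined by $Q_0(x)=1$, $Q_1(x)=x$, and $Q_{j+2}(x)=x\,Q_{j+1}(x)-c_{l-j}\,Q_j(x)$ for all $0\le j\le l-1$. *)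

theory Defs
  imports
    "Graph_Theory.Pair_Digraph"
    "Graph_Theory.Digraph_Component"
    "Jordan_Normal_Form.Spectral_Radius"
begin

text \<open>A finite simple graph is a \<^locale>\<open>pair_graph\<close>: finite, loop-free, without parallel arcs,
  and with symmetric arcs, an edge being represented by its two orientations.
  Consequently \<^const>\<open>out_degree\<close> is the ordinary vertex degree.
  The constant \<^const>\<open>tree\<close> is not suitable here: with symmetric arcs it counts
  every single edge, traversed back and forth, as a cycle. Genuine cycles have length at least 3.\<close>

definition undirected_tree :: "'a pair_pre_digraph \<Rightarrow> bool" where
  "undirected_tree T \<longleftrightarrow>
     pair_graph T \<and> Digraph_Component.connected (with_proj T) \<and>
     \<not> (\<exists>p. pre_digraph.cycle (with_proj T) p \<and> 3 \<le> length p)"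

text \<open>The level of a vertex is its distance from the root \<open>r\<close>.\<close>

definition level :: "'a pair_pre_digraph \<Rightarrow> 'a \<Rightarrow> 'a \<Rightarrow> nat" where
  "level T r v = (LEAST k. \<exists>p. pre_digraph.awalk (with_proj T) r p v \<and> length p = k)"

definition height :: "'a pair_pre_digraph \<Rightarrow> 'a \<Rightarrow> nat" where
  "height T r = Max (level T r ` pverts T)"

definition children :: "'a pair_pre_digraph \<Rightarrow> 'a \<Rightarrow> 'a \<Rightarrow> 'a set" where
  "children T r v = {w. (v, w) \<in> parcs T \<and> level T r w = Suc (level T r v)}"

definition balanced_tree :: "'a pair_pre_digraph \<Rightarrow> 'a \<Rightarrow> bool" where
  "balanced_tree T r \<longleftrightarrow>
     undirected_tree T \<and> r \<in> pverts T \<and>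
     (\<forall>u\<in>pverts T. \<forall>v\<in>pverts T. level T r u = level T r v \<longrightarrow>
        out_degree (with_proj T) u = out_degree (with_proj T) v)"

text \<open>The tuple \<open>(c\<^sub>1, \<dots>, c\<^sub>l)\<close> is the list \<open>C\<close> with \<open>c\<^sub>j = C ! (j - 1)\<close>, so
  that \<open>C ! i\<close> is the number of children of each vertex in level \<open>i\<close>.
  It is the empty list for the one-vertex tree.\<close>

definition characteristic_tuple :: "'a pair_pre_digraph \<Rightarrow> 'a \<Rightarrow> nat list \<Rightarrow> bool" where
  "characteristic_tuple T r C \<longleftrightarrow>
     length C = height T r \<and> (\<forall>c\<in>set C. 0 < c) \<and>
     (\<forall>v\<in>pverts T. level T r v < length C \<longrightarrow> card (children T r v) = C ! level T r v)"

text \<open>The index is an integer so that the number of vertices in level \<open>-1\<close> is \<open>0\<close>.\<close>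

definition level_size :: "'a pair_pre_digraph \<Rightarrow> 'a \<Rightarrow> int \<Rightarrow> nat" where
  "level_size T r k = card {v \<in> pverts T. int (level T r v) = k}"

text \<open>In the third equation \<open>C ! (length C - Suc j)\<close> is \<open>c\<^sub>l\<^sub>-\<^sub>j\<close>. The values of \<open>Q C j\<close>
  for \<open>j > length C + 1\<close> have no meaning and are never used.\<close>

fun Q :: "nat list \<Rightarrow> nat \<Rightarrow> complex poly" where
  "Q C 0 = 1"
| "Q C (Suc 0) = [:0, 1:]"
| "Q C (Suc (Suc j)) =
     [:0, 1:] * Q C (Suc j) - Polynomial.smult (of_nat (C ! (length C - Suc j))) (Q C j)"

text \<open>The adjacency matrix with respect to an enumeration \<open>vs\<close> of the vertices. Another enumeration
  conjugates it by a permutation matrix, so the set of eigenvalues depends on the graph alone.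
  The entries are taken in the complex numbers, so that no eigenvalue is lost.\<close>

definition adjacency_matrix :: "'a pair_pre_digraph \<Rightarrow> 'a list \<Rightarrow> complex mat" where
  "adjacency_matrix G vs =
     mat (length vs) (length vs) (\<lambda>(i, j). if (vs ! i, vs ! j) \<in> parcs G then 1 else 0)"

end

theory Submission
  imports Defs
begin

text \<open>The polynomial recurrence is the eigenvalue equation read from the leaves upwards: every function
  \<open>f\<close> with \<open>A f = x f\<close> satisfies \<open>Q\<^sub>k(x) f(v) = Q\<^sub>k\<^sub>-\<^sub>1(x) f(parent v)\<close> for \<open>v\<close> in level \<open>l + 1 - k\<close>, the
  right-hand side being \<open>0\<close> at the root. If \<open>Q\<^sub>j(x) \<noteq> 0\<close> for all \<open>j \<in> \<Phi>\<close>, then \<open>f\<close> vanishes, from the root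
  downwards; for \<open>k \<notin> \<Phi>\<close> the vertex \<open>v\<close> is an only child, and \<open>f(v) = 0\<close> follows from the equation at
  its parent. Conversely, if \<open>Q\<^sub>j(x) = 0\<close>, the function with value \<open>Q\<^sub>l\<^sub>-\<^sub>i(x)\<close> in level \<open>i\<close> solves the equation
  inside each branch whose top lies in level \<open>l + 1 - j\<close>. For \<open>j = l + 1\<close> that branch is the whole tree;
  for smaller \<open>j \<in> \<Phi>\<close> one takes opposite signs on the branches of two siblings.\<close>

section \<open>Eigenvectors as functions on the vertices\<close>

lemma mem_spectrum_adjacency_matrix_iff:
  fixes x :: complex
  assumes "distinct vs" "set vs = pverts G"
  shows "x \<in> spectrum (adjacency_matrix G vs) \<longleftrightarrow>
    (\<exists>f. (\<exists>v\<in>pverts G. f v \<noteq> 0) \<and>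
      (\<forall>v\<in>pverts G. (\<Sum>u\<in>{u\<in>pverts G. (v, u) \<in> parcs G}. f u) = x * f v))"
    (is "_ \<longleftrightarrow> (\<exists>f. ?nonzero f \<and> ?eigen f)")
proof -
  let ?n = "length vs" and ?A = "adjacency_matrix G vs"
  have dim: "dim_row ?A = ?n" "dim_col ?A = ?n"
    by (simp_all add: adjacency_matrix_def)
  have bij: "bij_betw ((!) vs) {..<?n} (pverts G)"
    using assms by (intro bij_betw_nth) auto
  have fin: "finite (pverts G)"
    using assms(2) by (metis List.finite_set)
  have mult: "(?A *\<^sub>v vec ?n (\<lambda>i. f (vs ! i))) $ i =
      (\<Sum>u\<in>{u\<in>pverts G. (vs ! i, u) \<in> parcs G}. f u)" if "i < ?n" for f i
  proof -
    have "(?A *\<^sub>v vec ?n (\<lambda>i. f (vs ! i))) $ i =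
        (\<Sum>j<?n. if (vs ! i, vs ! j) \<in> parcs G then f (vs ! j) else 0)"
      using that by (auto simp: adjacency_matrix_def scalar_prod_def lessThan_atLeast0 intro!: sum.cong)
    also have "\<dots> = (\<Sum>u\<in>pverts G. if (vs ! i, u) \<in> parcs G then f u else 0)"
      by (rule sum.reindex_bij_betw[OF bij])
    also have "\<dots> = (\<Sum>u\<in>{u\<in>pverts G. (vs ! i, u) \<in> parcs G}. f u)"
      using fin by (simp add: sum.inter_filter)
    finally show ?thesis .
  qed
  have ball: "(\<forall>v\<in>pverts G. P v) \<longleftrightarrow> (\<forall>i<?n. P (vs ! i))" for P
    using assms(2) by (metis in_set_conv_nth nth_mem)
  have *: "eigenvector ?A (vec ?n (\<lambda>i. f (vs ! i))) x \<longleftrightarrow> ?nonzero f \<and> ?eigen f" for f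
  proof -
    have "?nonzero f \<longleftrightarrow> vec ?n (\<lambda>i. f (vs ! i)) \<noteq> 0\<^sub>v ?n"
      using ball[of "\<lambda>v. f v = 0"] by (auto simp: vec_eq_iff)
    moreover have "?eigen f \<longleftrightarrow>
        ?A *\<^sub>v vec ?n (\<lambda>i. f (vs ! i)) = x \<cdot>\<^sub>v vec ?n (\<lambda>i. f (vs ! i))"
      unfolding vec_eq_iff ball using mult by (auto simp: dim simp del: index_mult_mat_vec)
    ultimately show ?thesis
      by (auto simp: eigenvector_def dim)
  qed
  \<comment> \<open>Inverting the enumeration shows that passing to functions loses no
    vector.\<close>
  have "\<exists>f. w = vec ?n (\<lambda>i. f (vs ! i))" if "w \<in> carrier_vec ?n" for w :: "complex vec"
  proof
    have "inv_into {..<?n} ((!) vs) (vs ! i) = i" if "i < ?n" for i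
      using bij that by (intro inv_into_f_f) (auto simp: bij_betw_def)
    then show "w = vec ?n (\<lambda>i. (\<lambda>u. w $ inv_into {..<?n} ((!) vs) u) (vs ! i))"
      using that by (auto simp: vec_eq_iff)
  qed
  then have "(\<exists>w. eigenvector ?A w x) \<longleftrightarrow> (\<exists>f. eigenvector ?A (vec ?n (\<lambda>i. f (vs ! i))) x)"
    by (metis eigenvector_def dim(1))
  then show ?thesis
    by (simp add: spectrum_def eigenvalue_def *)
qed

section \<open>Levels, parents and children in a rooted tree\<close>

locale rooted_tree = pair_graph T for T :: "'a pair_pre_digraph" +
  fixes r :: 'a
  assumes reachable_all: "\<And>u v. u \<in> pverts T \<Longrightarrow> v \<in> pverts T \<Longrightarrow> \<exists>p. awalk u p v"
    and acyclic: "\<not> (\<exists>p. cycle p \<and> 3 \<le> length p)"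
    and root: "r \<in> pverts T"
begin

abbreviation lev :: "'a \<Rightarrow> nat" where "lev \<equiv> level T r"
abbreviation chld :: "'a \<Rightarrow> 'a set" where "chld \<equiv> children T r"

lemma level_le: "awalk r p v \<Longrightarrow> lev v \<le> length p"
  unfolding level_def by (rule Least_le) auto

lemma shortest_awalk:
  assumes "v \<in> pverts T"
  obtains p where "awalk r p v" "length p = lev v"
proof -
  obtain p where "awalk r p v" using reachable_all[OF root assms] ..
  then have "\<exists>q. awalk r q v \<and> length q = lev v"
    unfolding level_def by (intro LeastI_ex[where P = "\<lambda>k. \<exists>q. awalk r q v \<and> length q = k"]) blast
  then show ?thesis using that by blast
qed

lemma level_arc_le:
  assumes "(u, v) \<in> parcs T"
  shows "lev v \<le> Suc (lev u)"
proof -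
  obtain p where p: "awalk r p u" "length p = lev u"
    using shortest_awalk in_arcsD1[OF assms] by blast
  then have "awalk r (p @ [(u, v)]) v"
    using assms by (intro awalk_appendI[of r p u]) (auto simp: awalk_simps in_arcsD2)
  from level_le[OF this] p show ?thesis by simp
qed

lemma level_root [simp]: "lev r = 0"
  using level_le[of "[]" r] root by (simp add: awalk_Nil_iff)

lemma level_eq_0_iff: "v \<in> pverts T \<Longrightarrow> lev v = 0 \<longleftrightarrow> v = r"
  by (metis awalk_empty_ends length_0_conv level_root shortest_awalk)

text \<open>The last arc of a shortest walk from the root comes from a parent.\<close>

lemma exists_parent:
  assumes "v \<in> pverts T" "v \<noteq> r"
  shows "\<exists>u. v \<in> chld u"
proof -
  obtain p where p: "awalk r p v" "length p = lev v"
    using shortest_awalk assms by blast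
  with assms have "p \<noteq> []" by (auto simp: awalk_Nil_iff)
  then obtain q e where q: "p = q @ [e]" by (metis rev_exhaust)
  obtain u w where e: "e = (u, w)" by force
  from p q e have "awalk r q u" "(u, v) \<in> parcs T"
    by (auto simp: awalk_simps)
  moreover have "lev v = Suc (lev u)"
    using level_le[OF \<open>awalk r q u\<close>] level_arc_le[OF \<open>(u, v) \<in> parcs T\<close>] p(2) q by auto
  ultimately show ?thesis by (auto simp: children_def)
qed

lemma apath_snoc:
  assumes "apath u p v" "(v, w) \<in> parcs T" "w \<notin> set (awalk_verts u p)"
  shows "apath u (p @ [(v, w)]) w" "set (awalk_verts u (p @ [(v, w)])) = insert w (set (awalk_verts u p))"
proof -
  have *: "awalk u p v" using assms(1) by (rule awalkI_apath)
  then have "awalk u (p @ [(v, w)]) w"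
    using assms by (auto simp: awalk_simps in_arcsD2)
  then show "apath u (p @ [(v, w)]) w"
    using assms * by (simp add: apath_def awalk_verts_append)
  show "set (awalk_verts u (p @ [(v, w)])) = insert w (set (awalk_verts u p))"
    using \<open>awalk u (p @ [(v, w)]) w\<close> * by (auto simp: awalk_verts_append)
qed

text \<open>Acyclicity enters here: the arc would close the path to a cycle of length at least
  3.\<close>

lemma no_closing_arc:
  assumes "apath u p v" "2 \<le> length p"
  shows "(v, u) \<notin> parcs T"
proof
  assume "(v, u) \<in> parcs T"
  then have "awalk v ((v, u) # p) v" "distinct (tl (awalk_verts v ((v, u) # p)))"
    using assms by (auto simp: awalk_simps apath_def)
  then have "cycle ((v, u) # p)" by (auto simp: cycle_def)
  with acyclic assms show False by (metis length_Cons Suc_le_mono numeral_3_eq_3 numeral_2_eq_2)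
qed

text \<open>Joining the paths between the two parents, one level up, avoids any reference to the last
  common ancestor.\<close>

lemma join_level:
  assumes "u \<in> pverts T" "v \<in> pverts T" "u \<noteq> v" "lev u = k" "lev v = k"
  shows "\<exists>p. apath u p v \<and> 2 \<le> length p \<and> (\<forall>w\<in>set (awalk_verts u p). lev w \<le> k)"
  using assms
proof (induction k arbitrary: u v)
  case 0
  then show ?case by (metis level_eq_0_iff)
next
  case (Suc k)
  then have "u \<noteq> r" "v \<noteq> r" by auto
  with Suc.prems obtain a b where ab: "u \<in> chld a" "v \<in> chld b"
    using exists_parent by metis
  then have arcs: "(a, u) \<in> parcs T" "(u, a) \<in> parcs T" "(b, v) \<in> parcs T"
    and levels: "lev a = k" "lev b = k"
    using Suc.prems by (auto simp: children_def intro: arcs_symmetric)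
  have "\<exists>p. apath a p b \<and> (\<forall>w\<in>set (awalk_verts a p). lev w \<le> k)"
  \<comment> \<open>The induction hypothesis asks for distinct vertices, so a common parent gets the
    empty path.\<close>
  proof (cases "a = b")
    case True
    then show ?thesis using levels in_arcsD1[OF arcs(1)]
      by (intro exI[of _ "[]"]) (auto simp: apath_Nil_iff)
  next
    case False
    then show ?thesis using Suc.IH[of a b] levels in_arcsD1 arcs by blast
  qed
  then obtain p where p: "apath a p b" "\<forall>w\<in>set (awalk_verts a p). lev w \<le> k" by blast
  \<comment> \<open>\<open>p\<close> stays in levels up to \<open>k\<close>, so the endpoints
    \<open>u\<close> and \<open>v\<close> in level \<open>Suc k\<close> are off it and the extension
    is again a path.\<close>
  then have p1: "apath u ((u, a) # p) b"
    using arcs Suc.prems by (auto simp: apath_Cons_iff)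
  have vs: "set (awalk_verts u ((u, a) # p)) = insert u (set (awalk_verts a p))" by simp
  have "v \<notin> set (awalk_verts u ((u, a) # p))"
    using p Suc.prems unfolding vs by auto
  from apath_snoc[OF p1 arcs(3) this] show ?case
    unfolding vs using p(2) Suc.prems
    by (intro exI[of _ "((u, a) # p) @ [(b, v)]"]) auto
qed

text \<open>Two distinct vertices of one level are joined by a path of length at least 2, which an
  arc between them would close.\<close>

lemma level_arc_neq:
  assumes "(u, v) \<in> parcs T"
  shows "lev u \<noteq> lev v"
proof
  assume "lev u = lev v"
  then obtain p where "apath v p u" "2 \<le> length p"
    using join_level[of v u] assms no_loops' in_arcsD1 in_arcsD2 by metis
  then show False using no_closing_arc assms by blast
qed

text \<open>A path joining two parents of \<open>w\<close> within levels up to theirs avoids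
  \<open>w\<close>; returning through \<open>w\<close> would close a cycle.\<close>

lemma parent_unique:
  assumes "w \<in> chld u" "w \<in> chld v"
  shows "u = v"
proof (rule ccontr)
  assume "u \<noteq> v"
  from assms have arcs: "(u, w) \<in> parcs T" "(v, w) \<in> parcs T" "lev w = Suc (lev v)" "lev u = lev v"
    by (auto simp: children_def)
  then obtain p where p: "apath u p v" "2 \<le> length p" "\<forall>a\<in>set (awalk_verts u p). lev a \<le> lev v"
    using join_level[of u v] \<open>u \<noteq> v\<close> in_arcsD1 by metis
  then have "w \<notin> set (awalk_verts u p)"
    using arcs by auto
  from no_closing_arc[OF apath_snoc(1)[OF p(1) arcs(2) this]] p(2) have "(w, u) \<notin> parcs T"
    by simp
  with arcs arcs_symmetric show False by blast
qed

text \<open>The value at the root is unspecified, since no vertex has the root as a child.\<close>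

definition parent :: "'a \<Rightarrow> 'a" where
  "parent v = (THE u. v \<in> chld u)"

lemma parent_eq: "v \<in> chld u \<Longrightarrow> parent v = u"
  unfolding parent_def using parent_unique by blast

lemma in_children_parent: "v \<in> pverts T \<Longrightarrow> v \<noteq> r \<Longrightarrow> v \<in> chld (parent v)"
  using exists_parent parent_eq by metis

lemma childrenD:
  assumes "w \<in> chld v"
  shows "w \<in> pverts T" "v \<in> pverts T" "lev w = Suc (lev v)" "parent w = v" "w \<noteq> r"
  using assms parent_eq[OF assms] by (auto simp: children_def in_arcsD1 in_arcsD2)

lemma parentD:
  assumes "v \<in> pverts T" "v \<noteq> r"
  shows "parent v \<in> pverts T" "lev v = Suc (lev (parent v))"
  using childrenD[OF in_children_parent[OF assms]] by auto

lemma finite_children [simp]: "finite (chld v)"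
  using childrenD(1) by (intro finite_subset[OF _ pair_finite_verts]) auto

text \<open>An arc joins consecutive levels, so every neighbour is a child or the unique parent,
  never both.\<close>

lemma sum_neighbours:
  fixes f :: "'a \<Rightarrow> 'b :: comm_monoid_add"
  assumes "v \<in> pverts T"
  shows "(\<Sum>u\<in>{u\<in>pverts T. (v, u) \<in> parcs T}. f u) =
    (\<Sum>u\<in>chld v. f u) + (if v = r then 0 else f (parent v))"
proof -
  have "u \<in> chld v \<or> (v \<noteq> r \<and> u = parent v)" if "(v, u) \<in> parcs T" for u
  proof (cases "u \<in> chld v")
    case False
    have "(u, v) \<in> parcs T" using that by (rule arcs_symmetric)
    then have "v \<in> chld u"
      using False that level_arc_le[of u v] level_arc_le[of v u] level_arc_neq[of u v]
      by (auto simp: children_def)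
    then show ?thesis using childrenD by blast
  qed simp
  moreover have "(v, parent v) \<in> parcs T" if "v \<noteq> r"
    using in_children_parent[OF assms that] by (auto simp: children_def intro: arcs_symmetric)
  ultimately have *: "{u\<in>pverts T. (v, u) \<in> parcs T} = chld v \<union> (if v = r then {} else {parent v})"
    by (auto simp: in_arcsD2) (auto simp: children_def in_arcsD2)
  moreover have "parent v \<notin> chld v" if "v \<noteq> r"
    using parentD(2)[OF assms that] childrenD(3) by fastforce
  ultimately show ?thesis by (auto simp: sum.union_disjoint add.commute)
qed

section \<open>Branches of the tree\<close>

text \<open>The branch with top \<open>w\<close>, including \<open>w\<close>. As the levels fix the
  number of steps, branches with tops in one level are fibres of a single function, hence
  disjoint.\<close>

definition descendants :: "'a \<Rightarrow> 'a set" where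
  "descendants w = {v \<in> pverts T. lev w \<le> lev v \<and> (parent ^^ (lev v - lev w)) v = w}"

lemma child_in_descendants_iff:
  assumes "u \<in> chld v"
  shows "u \<in> descendants w \<longleftrightarrow> v \<in> descendants w \<or> (u = w)"
proof (cases "lev w \<le> lev v")
  case True
  then have "lev u - lev w = Suc (lev v - lev w)" using childrenD[OF assms] by auto
  then show ?thesis
    using True childrenD[OF assms] by (auto simp: descendants_def funpow_Suc_right simp del: funpow.simps)
next
  case False
  with childrenD[OF assms] show ?thesis
    by (cases "lev w = lev u") (auto simp: descendants_def)
qed

lemma descendants_level_le: "v \<in> descendants w \<Longrightarrow> lev w \<le> lev v"
  by (simp add: descendants_def)

lemma parent_in_descendants_iff:
  assumes "v \<in> pverts T" "v \<noteq> r" "v \<noteq> w"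
  shows "parent v \<in> descendants w \<longleftrightarrow> v \<in> descendants w"
  using child_in_descendants_iff[OF in_children_parent[OF assms(1,2)]] assms(3) by auto

lemma self_in_descendants: "w \<in> pverts T \<Longrightarrow> w \<in> descendants w"
  by (simp add: descendants_def)

lemma descendants_disjoint:
  "lev u = lev w \<Longrightarrow> u \<noteq> w \<Longrightarrow> v \<in> descendants u \<Longrightarrow> v \<notin> descendants w"
  by (auto simp: descendants_def)

end

section \<open>Level sizes and the recurrence in terms of children\<close>

locale characterized_tree = rooted_tree +
  fixes C :: "nat list"
  assumes tuple: "characteristic_tuple T r C"
begin

abbreviation l :: nat where "l \<equiv> length C"

lemma level_le_height: "v \<in> pverts T \<Longrightarrow> lev v \<le> l"
  using tuple pair_finite_verts by (simp add: characteristic_tuple_def height_def)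

lemma card_children: "v \<in> pverts T \<Longrightarrow> lev v < l \<Longrightarrow> card (chld v) = C ! lev v"
  using tuple by (simp add: characteristic_tuple_def)

lemma children_leaf: "v \<in> pverts T \<Longrightarrow> \<not> lev v < l \<Longrightarrow> chld v = {}"
  using childrenD(1,3) level_le_height by fastforce

text \<open>Taking the number of children as coefficient covers the leaves too: there it is 0, which
  cancels the truncated index, and \<open>Q C 1 = x * Q C 0\<close> remains.\<close>

lemma Q_step:
  assumes "v \<in> pverts T"
  shows "of_nat (card (chld v)) * poly (Q C (l - Suc (lev v))) x + poly (Q C (Suc (l - lev v))) x
    = x * poly (Q C (l - lev v)) x"
proof (cases "lev v < l")
  case True
  \<comment> \<open>With \<open>j = l - Suc (lev v)\<close> the coefficient in the recurrence is
    \<open>C ! lev v\<close>.\<close>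
  then have eq: "l - lev v = Suc (l - Suc (lev v))" "l - Suc (l - Suc (lev v)) = lev v" by auto
  show ?thesis
    unfolding eq(1) Q.simps(3) by (simp add: eq(2) card_children[OF assms True])
next
  case False
  with level_le_height[OF assms] show ?thesis
    by (simp add: children_leaf[OF assms False])
qed

text \<open>Entries of the tuple are positive, so one can descend to level \<open>l\<close>. The
  leaf found serves to show that branch vectors are nonzero.\<close>

lemma leaf_below:
  assumes "w \<in> pverts T"
  shows "\<exists>v \<in> descendants w. lev v = l"
  using assms
proof (induction "l - lev w" arbitrary: w)
  case 0
  then have "lev w = l" using level_le_height[of w] by simp
  then show ?case using self_in_descendants[OF 0(2)] by blast
next
  case (Suc k)
  then have "card (chld w) > 0"
    using tuple by (simp add: card_children characteristic_tuple_def)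
  then obtain u where u: "u \<in> chld w" by fastforce
  then obtain v where v: "v \<in> descendants u" "lev v = l"
    using Suc childrenD[OF u] by (metis Suc_diff_Suc diff_Suc_1 zero_less_Suc zero_less_diff)
  have "(parent ^^ (lev v - lev w)) v = w"
  proof -
    have "lev v - lev w = Suc (lev v - lev u)"
      using v childrenD[OF u] descendants_level_le[OF v(1)] by auto
    then show ?thesis using v(1) childrenD[OF u] by (simp add: descendants_def)
  qed
  then have "v \<in> descendants w"
    using v childrenD[OF u] by (simp add: descendants_def)
  with v show ?case by blast
qed

text \<open>Parents are unique, so the sets of children partition the next level. Thus, below the
  root, membership in \<Phi> amounts to an entry of at least 2.\<close>

lemma level_size_Suc:
  assumes "i < l"
  shows "level_size T r (int (Suc i)) = level_size T r (int i) * C ! i"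
proof -
  let ?L = "\<lambda>i. {v \<in> pverts T. lev v = i}"
  have fin: "finite (?L i)" using pair_finite_verts by simp
  have "?L (Suc i) = (\<Union>u\<in>?L i. chld u)"
  proof (intro equalityI subsetI)
    fix v assume "v \<in> ?L (Suc i)"
    then have v: "v \<in> pverts T" "lev v = Suc i" "v \<noteq> r" by auto
    then show "v \<in> (\<Union>u\<in>?L i. chld u)"
      using in_children_parent[OF v(1,3)] parentD[OF v(1,3)] by auto
  next
    fix v assume "v \<in> (\<Union>u\<in>?L i. chld u)"
    then obtain u where "v \<in> chld u" "lev u = i" by blast
    then show "v \<in> ?L (Suc i)" using childrenD(1,3) by blast
  qed
  then have "card (?L (Suc i)) = (\<Sum>u\<in>?L i. card (chld u))"
    using parent_unique by (subst card_UN_disjoint[OF fin, symmetric]) auto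
  also have "\<dots> = (\<Sum>u\<in>?L i. C ! i)"
    using assms by (intro sum.cong) (auto simp: card_children)
  finally have "card (?L (Suc i)) = card (?L i) * C ! i" by simp
  then show ?thesis by (simp add: level_size_def del: of_nat_Suc)
qed

section \<open>Eigenvectors built on branches\<close>

text \<open>Indices count levels from the leaves, where \<open>Q C 0 = 1\<close> keeps the function
  nonzero for every \<open>x\<close>.\<close>

definition branch_vec :: "complex \<Rightarrow> 'a \<Rightarrow> 'a \<Rightarrow> complex" where
  "branch_vec x w v = (if v \<in> descendants w then poly (Q C (l - lev v)) x else 0)"

text \<open>The eigenvalue equation for \<open>branch_vec x w\<close> fails only at \<open>parent w\<close>, and there the defect
  depends on \<open>w\<close> through its level only; it cancels in the difference of two siblings.\<close>

lemma sum_neighbours_branch_vec: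
  assumes w: "w \<in> pverts T" and v: "v \<in> pverts T"
    and root_of_Q: "poly (Q C (Suc (l - lev w))) x = 0"
  shows "(\<Sum>u\<in>{u\<in>pverts T. (v, u) \<in> parcs T}. branch_vec x w u) =
    x * branch_vec x w v + (if w \<in> chld v then poly (Q C (l - lev w)) x else 0)"
proof (cases "v \<in> descendants w")
  case True
  have "w \<notin> chld v"
    using descendants_level_le[OF True] childrenD(3)[of w v] by auto
  have "(\<Sum>u\<in>chld v. branch_vec x w u) = (\<Sum>u\<in>chld v. poly (Q C (l - Suc (lev v))) x)"
    using True by (intro sum.cong) (auto simp: branch_vec_def child_in_descendants_iff childrenD)
  moreover have "(if v = r then 0 else branch_vec x w (parent v)) = poly (Q C (Suc (l - lev v))) x"
  \<comment> \<open>At the top the parent lies outside the branch and contributes 0, which is the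
    required value exactly because \<open>x\<close> is a root.\<close>
  proof (cases "v = w")
    case True
    then show ?thesis
      using root_of_Q descendants_level_le[of "parent w" w] parentD[OF w] by (auto simp: branch_vec_def)
  next
    case False
    then have "v \<noteq> r"
      using True descendants_level_le[OF True] w by (auto simp: level_eq_0_iff)
    moreover from this have "l - lev (parent v) = Suc (l - lev v)"
      using parentD[OF v] level_le_height[OF v] by auto
    ultimately show ?thesis
      using True False v by (auto simp: branch_vec_def parent_in_descendants_iff)
  qed
  ultimately show ?thesis
    using Q_step[OF v, of x] \<open>w \<notin> chld v\<close> True
    by (simp add: sum_neighbours[OF v] branch_vec_def[of x w v])
next
  case False
  then have "v \<noteq> w" using self_in_descendants w by blast
  then have "(if v = r then 0 else branch_vec x w (parent v)) = 0"
    using False v by (auto simp: branch_vec_def parent_in_descendants_iff)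
  \<comment> \<open>Seen from outside, the branch can be entered only at its top.\<close>
  moreover have "(\<Sum>u\<in>chld v. branch_vec x w u) =
      (\<Sum>u\<in>chld v. if u = w then poly (Q C (l - lev w)) x else 0)"
    using False by (intro sum.cong) (auto simp: branch_vec_def child_in_descendants_iff)
  ultimately show ?thesis
    using False by (simp add: sum_neighbours[OF v] branch_vec_def[of x w v])
qed

lemma branch_vec_leaf: "v \<in> descendants w \<Longrightarrow> lev v = l \<Longrightarrow> branch_vec x w v = 1"
  by (simp add: branch_vec_def)

lemma eigenvector_of_root_of_Q:
  assumes j: "1 \<le> j" "j \<le> l + 1"
    and size: "level_size T r (int l + 1 - int j) > level_size T r (int l - int j)"
    and x: "poly (Q C j) x = 0"
  shows "\<exists>f. (\<exists>v\<in>pverts T. f v \<noteq> 0) \<and>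
      (\<forall>v\<in>pverts T. (\<Sum>u\<in>{u\<in>pverts T. (v, u) \<in> parcs T}. f u) = x * f v)"
proof (cases "j = l + 1")
  case True
  obtain v where "v \<in> descendants r" "lev v = l" using leaf_below[OF root] by blast
  then have "v \<in> pverts T" "branch_vec x r v \<noteq> 0"
    by (auto simp: branch_vec_leaf) (simp add: descendants_def)
  \<comment> \<open>The root is nobody's child, so no defect arises.\<close>
  moreover have "r \<notin> chld v" for v using childrenD(5) by blast
  ultimately show ?thesis
    using sum_neighbours_branch_vec[OF root, of _ x] x True by (intro exI[of _ "branch_vec x r"]) auto
next
  case False
  \<comment> \<open>Level \<open>i\<close> holds the parents of the branch tops;
    \<open>j \<le> l\<close> here, so the subtraction is exact.\<close>
  define i where "i = l - j"
  with j False have i: "i < l" "Suc (l - Suc i) = j"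
    and ints: "int l + 1 - int j = int (Suc i)" "int l - int j = int i" by auto
  \<comment> \<open>Cancelling the size of level \<open>i\<close> leaves at least two children per
    parent, hence two siblings.\<close>
  have "level_size T r (int i) * C ! i > level_size T r (int i) * 1"
    using size unfolding ints level_size_Suc[OF i(1)] by simp
  then have "1 < C ! i" "level_size T r (int i) \<noteq> 0" by (auto simp only: mult_less_cancel1 mult_0)
  then obtain p where p: "p \<in> pverts T" "lev p = i"
    unfolding level_size_def by (metis (mono_tags, lifting) card.empty empty_Collect_eq of_nat_eq_iff)
  with i \<open>1 < C ! i\<close> have "1 < card (chld p)" by (simp add: card_children)
  then have "\<exists>a\<in>chld p. \<exists>b\<in>chld p. a \<noteq> b"
    by (metis card_le_Suc0_iff_eq finite_children not_less One_nat_def)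
  then obtain a b where ab: "a \<in> chld p" "b \<in> chld p" "a \<noteq> b" by blast
  note a = childrenD[OF ab(1)] and b = childrenD[OF ab(2)]
  let ?f = "\<lambda>v. branch_vec x a v - branch_vec x b v"
  obtain v where v: "v \<in> descendants a" "lev v = l" using leaf_below a(1) by blast
  then have "?f v = 1"
    using descendants_disjoint[of a b v] a b ab by (simp add: branch_vec_leaf) (simp add: branch_vec_def)
  moreover have "v \<in> pverts T" using v by (simp add: descendants_def)
  moreover have "(\<Sum>u\<in>{u\<in>pverts T. (v, u) \<in> parcs T}. ?f u) = x * ?f v" if "v \<in> pverts T" for v
  proof -
    have "a \<in> chld v \<longleftrightarrow> v = p" "b \<in> chld v \<longleftrightarrow> v = p"
      using ab parent_unique by blast+
    then show ?thesis
      using sum_neighbours_branch_vec[OF a(1) that, of x] sum_neighbours_branch_vec[OF b(1) that, of x]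
        x a b p i by (simp add: sum_subtractf right_diff_distrib)
  qed
  ultimately show ?thesis by (intro exI[of _ ?f]) (auto intro!: bexI[of _ v])
qed

section \<open>From eigenvectors to roots of the polynomials\<close>

text \<open>Induction from the leaves upwards: multiplying the equation at \<open>v\<close> by
  \<open>Q C (l - lev v)\<close> turns each child term into a multiple of \<open>f v\<close>, and
  \<open>Q_step\<close> collects them. Nothing is divided, so zeros of the polynomials are
  allowed.\<close>

lemma eigenvector_ratio:
  assumes eigen: "\<And>v. v \<in> pverts T \<Longrightarrow> (\<Sum>u\<in>{u\<in>pverts T. (v, u) \<in> parcs T}. f u) = x * f v"
    and v: "v \<in> pverts T"
  shows "poly (Q C (Suc (l - lev v))) x * f v =
    poly (Q C (l - lev v)) x * (if v = r then 0 else f (parent v))"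
  using v
proof (induction "l - lev v" arbitrary: v rule: less_induct)
  case less
  have "poly (Q C (l - lev v)) x * (\<Sum>u\<in>chld v. f u) =
      (\<Sum>u\<in>chld v. poly (Q C (l - Suc (lev v))) x * f v)"
    unfolding sum_distrib_left
  proof (rule sum.cong)
    fix u assume u: "u \<in> chld v"
    have "l - lev u < l - lev v" "Suc (l - lev u) = l - lev v" "l - lev u = l - Suc (lev v)"
      using level_le_height[OF childrenD(1)[OF u]] childrenD(3)[OF u] by linarith+
    then show "poly (Q C (l - lev v)) x * f u = poly (Q C (l - Suc (lev v))) x * f v"
      using less.hyps[of u] childrenD[OF u] by simp
  qed simp
  moreover have "x * f v = (\<Sum>u\<in>chld v. f u) + (if v = r then 0 else f (parent v))"
    using eigen[OF less.prems] sum_neighbours[OF less.prems, of f] by simp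
  ultimately have "poly (Q C (l - lev v)) x * (x * f v) =
      of_nat (card (chld v)) * (poly (Q C (l - Suc (lev v))) x * f v)
      + poly (Q C (l - lev v)) x * (if v = r then 0 else f (parent v))"
    by (simp only: distrib_left sum_constant)
  moreover have "poly (Q C (Suc (l - lev v))) x =
      x * poly (Q C (l - lev v)) x - of_nat (card (chld v)) * poly (Q C (l - Suc (lev v))) x"
    using Q_step[OF less.prems, of x] by (simp only: eq_diff_eq add.commute)
  ultimately show ?case
    by (simp only: right_diff_distrib mult_ac add_diff_cancel_left')
qed

lemma root_of_Q_of_eigenvector:
  assumes eigen: "\<And>v. v \<in> pverts T \<Longrightarrow> (\<Sum>u\<in>{u\<in>pverts T. (v, u) \<in> parcs T}. f u) = x * f v"
    and no_root: "\<And>j. 1 \<le> j \<Longrightarrow> j \<le> l + 1 \<Longrightarrow>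
      level_size T r (int l + 1 - int j) > level_size T r (int l - int j) \<Longrightarrow> poly (Q C j) x \<noteq> 0"
    and v: "v \<in> pverts T"
  shows "f v = 0"
  using v
proof (induction "lev v" arbitrary: v rule: less_induct)
  case less
  let ?j = "Suc (l - lev v)"
  show ?case
  proof (cases "v = r")
    case True
    \<comment> \<open>The index \<open>l + 1\<close> always lies in \<Phi>, because level 0 has one
      vertex and level -1 has none.\<close>
    have "{v \<in> pverts T. int (lev v) = 0} = {r}" using root by (auto simp: level_eq_0_iff)
    moreover have "{v \<in> pverts T. int (lev v) = -1} = {}" by auto
    ultimately have "poly (Q C (Suc l)) x \<noteq> 0"
      by (intro no_root) (simp_all add: level_size_def)
    then show ?thesis using eigenvector_ratio[OF eigen less.prems] True by simp
  next
    case False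
    define p where "p = parent v"
    define i where "i = lev p"
    have vp: "v \<in> chld p" using in_children_parent[OF less.prems False] by (simp add: p_def)
    note child = childrenD[OF vp]
    have fp: "f p = 0" using less.hyps child by simp
    have i: "i < l" "lev v = Suc i" using child level_le_height[of v] by (auto simp: i_def)
    show ?thesis
    proof (cases "C ! i \<ge> 2")
      case True
      have "level_size T r (int i) \<noteq> 0"
        using child pair_finite_verts by (auto simp: level_size_def i_def)
      with True have "level_size T r (int i) < level_size T r (int (Suc i))"
        by (simp add: level_size_Suc[OF i(1)] del: of_nat_Suc)
      moreover have "int l + 1 - int ?j = int (Suc i)" "int l - int ?j = int i" using i by auto
      ultimately have "level_size T r (int l - int ?j) < level_size T r (int l + 1 - int ?j)"
        by (simp only:)
      then have "poly (Q C ?j) x \<noteq> 0"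
        by (rule no_root[rotated 2]) simp_all
      then show ?thesis
        using eigenvector_ratio[OF eigen less.prems] False fp by (simp add: p_def)
    next
      \<comment> \<open>With \<open>v\<close> an only child, and \<open>f\<close> zero at
        \<open>p\<close> and at the parent of \<open>p\<close> (if any), the equation at
        \<open>p\<close> reduces to \<open>f v = 0\<close>. Reaching two levels up requires strong
        induction.\<close>
      case ge: False
      then have "card (chld p) \<le> Suc 0" using card_children[of p] child i by (simp add: i_def)
      then have "chld p = {v}" using vp card_le_Suc0_iff_eq[OF finite_children] by blast
      moreover have "(if p = r then 0 else f (parent p)) = 0"
        using less.hyps[of "parent p"] parentD[of p] child by auto
      ultimately show ?thesis
        using eigen[of p] sum_neighbours[of p f] child fp by simp
    qed
  qed
qed

end

theorem theorem4:
  fixes T :: "'a pair_pre_digraph" and r :: 'a and C :: "nat list" and vs :: "'a list"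
    and l :: nat and \<Phi> :: "nat set"
  assumes "balanced_tree T r"
    and "characteristic_tuple T r C"
    and "l = length C"
    and "\<Phi> = {j. 1 \<le> j \<and> j \<le> l + 1 \<and>
                level_size T r (int l + 1 - int j) > level_size T r (int l - int j)}"
    and "distinct vs" and "set vs = pverts T"
  shows "spectrum (adjacency_matrix T vs) = (\<Union>j\<in>\<Phi>. {x. poly (Q C j) x = 0})"
proof -
  have T: "pair_graph T" "Digraph_Component.connected (with_proj T)" "r \<in> pverts T"
    "\<not> (\<exists>p. pre_digraph.cycle (with_proj T) p \<and> 3 \<le> length p)"
    using assms(1) by (auto simp: balanced_tree_def undirected_tree_def)
  interpret pair_graph T by (rule T(1))
  \<comment> \<open>Arcs occur in both orientations, so connectedness yields directed walks.\<close>
  have "strongly_connected (with_proj T)"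
    using symmetric_connected_imp_strongly_connected[OF sym_arcs T(2)] .
  then have "\<exists>p. awalk u p v" if "u \<in> pverts T" "v \<in> pverts T" for u v
    using that by (simp add: strongly_connected_def reachable_awalk)
  then interpret characterized_tree T r C
    using T assms(2) by unfold_locales
  show ?thesis
  proof (intro equalityI subsetI)
    fix x assume "x \<in> spectrum (adjacency_matrix T vs)"
    then obtain f v where f: "v \<in> pverts T" "f v \<noteq> 0"
      "\<And>v. v \<in> pverts T \<Longrightarrow> (\<Sum>u\<in>{u\<in>pverts T. (v, u) \<in> parcs T}. f u) = x * f v"
      unfolding mem_spectrum_adjacency_matrix_iff[OF assms(5,6)] by blast
    show "x \<in> (\<Union>j\<in>\<Phi>. {x. poly (Q C j) x = 0})"
    proof (rule ccontr)
      assume "x \<notin> (\<Union>j\<in>\<Phi>. {x. poly (Q C j) x = 0})"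
      then have "f v = 0"
        using f(1,3) unfolding assms(3,4) by (intro root_of_Q_of_eigenvector[of f x]) auto
      with f(2) show False ..
    qed
  next
    fix x assume "x \<in> (\<Union>j\<in>\<Phi>. {x. poly (Q C j) x = 0})"
    then show "x \<in> spectrum (adjacency_matrix T vs)"
      unfolding mem_spectrum_adjacency_matrix_iff[OF assms(5,6)] assms(3,4)
      using eigenvector_of_root_of_Q[where x = x] by blast
  qed
qed

end
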